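(* Let $S$ be a set of $n-1$ points on a horizontal line $h$, let $x$ be a point not on $h$, and let $S'=S\cup\{x\}$ (so $|S'|=n$). Let $2\le l<k\le n$ be integers. Then $IJ(S',k,l)$ is connected if and only if $n\ge 3k-2l-1$ or $n=k$.
   Context: A subset $I$ of a finite point set $Q$ in the plane is an island if $I=Q\cap C$ for some convex set $C$; a $k$-island has exactly $k$ elements. $IJ(Q,k,l)$ is the graph whose vertices are the $k$-islands of $Q$, two adjacent if their intersection has exactly $l$ elements. *)

theory Defs
  imports "HOL-Analysis.Analysis" "Graph_Theory.Graph_Theory"
begin

definition island :: "(real \<times> real) set \<Rightarrow> (real \<times> real) set \<Rightarrow> bool" where
  "island Q I \<longleftrightarrow> (\<exists>C. convex C \<and> I = Q \<inter> C)"

definition k_island :: "(real \<times> real) set \<Rightarrow> nat \<Rightarrow> (real \<times> real) set \<Rightarrow> bool" where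
  "k_island Q k I \<longleftrightarrow> island Q I \<and> finite I \<and> card I = k"

text \<open>An undirected graph is represented as a symmetric digraph, each edge giving two arcs.\<close>

definition IJ :: "(real \<times> real) set \<Rightarrow> nat \<Rightarrow> nat \<Rightarrow> (real \<times> real) set pair_pre_digraph" where
  "IJ Q k l =
    \<lparr> pverts = {I. k_island Q k I},
      parcs = {(I, J). k_island Q k I \<and> k_island Q k J \<and> I \<noteq> J \<and>
                 finite (I \<inter> J) \<and> card (I \<inter> J) = l} \<rparr>"

lemma pair_graph_IJ:
  assumes "finite Q"
  shows "pair_graph (IJ Q k l)"
proof -
  have v: "{I. k_island Q k I} \<subseteq> Pow Q"
    by (auto simp: k_island_def island_def)
  then have fv: "finite {I. k_island Q k I}"
    using assms by (meson finite_Pow_iff finite_subset)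
  have "parcs (IJ Q k l) \<subseteq> {I. k_island Q k I} \<times> {I. k_island Q k I}"
    by (auto simp: IJ_def)
  then have fa: "finite (parcs (IJ Q k l))"
    using fv by (meson finite_SigmaI finite_subset)
  show ?thesis
    by unfold_locales (use fv fa in \<open>auto simp: IJ_def symmetric_def sym_def Int_commute\<close>)
qed

end

theory Submission
  imports Defs
begin

text \<open>
  The \<open>k\<close>-islands are the runs of \<open>k\<close> consecutive points of \<open>S\<close> and the runs of \<open>k - 1\<close>
  consecutive points together with \<open>x\<close>. Listed alternately from left to right they are numbered
  \<open>0, \<dots>, 2(n - k)\<close>, and since \<open>l \<ge> 2\<close>, two of them are adjacent iff their numbers differ by
  \<open>d\<close> or \<open>d + 1\<close>, where \<open>d = 2(k - l) - 1\<close>. Such a graph on \<open>N\<close> numbers is connected iff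
  \<open>N = 1\<close> or \<open>N \<ge> 2d\<close>: if \<open>N \<ge> 2d\<close>, every \<open>v\<close> descends to \<open>0\<close>, by the step to \<open>v - d\<close> if
  \<open>v \<ge> d\<close> and via \<open>v + d\<close> to \<open>v - 1\<close> otherwise; if \<open>N < 2d\<close>, the vertex
  \<open>min (d - 1) (N - 1)\<close> is isolated.
\<close>

section \<open>Connectedness of digraphs\<close>

lemma (in sym_digraph) connected_if_reachable_root:
  assumes "r \<in> verts G" and "\<And>v. v \<in> verts G \<Longrightarrow> v \<rightarrow>\<^sup>* r"
  shows "Digraph_Component.connected G"
proof (rule connectedI)
  show "verts G \<noteq> {}"
    using assms(1) by auto
  fix u v
  assume "u \<in> verts G" and "v \<in> verts G"
  then have "u \<rightarrow>\<^sup>* r" and "r \<rightarrow>\<^sup>* v"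
    using assms(2) by (auto intro: symmetric_reachable')
  then have "u \<rightarrow>\<^sup>* v"
    by (rule reachable_trans)
  then show "u \<rightarrow>\<^sup>*\<^bsub>mk_symmetric G\<^esub> v"
    by (rule reachable_mk_symmetricI)
qed

lemma connected_if_digraph_iso:
  assumes "wf_digraph G" and "digraph_iso G H" and "Digraph_Component.connected G"
  shows "Digraph_Component.connected H"
  using assms by (auto simp: digraph_iso_def intro: wf_digraph.connectedI_app_iso)

lemma connected_iff_if_digraph_iso:
  assumes "wf_digraph G" and "digraph_iso G H"
  shows "Digraph_Component.connected G \<longleftrightarrow> Digraph_Component.connected H"
proof -
  obtain f where "pre_digraph.digraph_isomorphism G f" and "H = app_iso f G"
    using assms(2) by (auto simp: digraph_iso_def)
  then have "wf_digraph H"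
    using wf_digraph.wf_digraphI_app_iso[OF assms(1)] by simp
  then show ?thesis
    using connected_if_digraph_iso[OF assms]
      connected_if_digraph_iso[OF _ digraph_iso_swap[OF assms]] by auto
qed

lemma digraph_iso_with_projI:
  assumes "pair_wf_digraph G" and "pair_wf_digraph H"
    and "bij_betw f (pverts G) (pverts H)"
    and "\<And>u v. u \<in> pverts G \<Longrightarrow> v \<in> pverts G \<Longrightarrow> (f u, f v) \<in> parcs H \<longleftrightarrow> (u, v) \<in> parcs G"
  shows "digraph_iso (with_proj G) (with_proj H)"
proof -
  interpret G: pair_wf_digraph G by fact
  interpret H: pair_wf_digraph H by fact
  let ?hom = "\<lparr>iso_verts = f, iso_arcs = map_prod f f, iso_head = snd, iso_tail = fst\<rparr>"
  have inj: "inj_on f (pverts G)" and surj: "f ` pverts G = pverts H"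
    using assms(3) by (simp_all add: bij_betw_def)
  have arcs_subset: "parcs G \<subseteq> pverts G \<times> pverts G"
    by (auto dest: G.wellformed')
  have "inj_on (map_prod f f) (parcs G)"
    using map_prod_inj_on[OF inj inj] arcs_subset by (rule inj_on_subset)
  then have "pre_digraph.digraph_isomorphism (with_proj G) ?hom"
    using inj G.wf_digraph_axioms by (simp add: G.digraph_isomorphism_def)
  moreover have "map_prod f f ` parcs G = parcs H"
  proof
    show "map_prod f f ` parcs G \<subseteq> parcs H"
      using assms(4) arcs_subset by auto
    show "parcs H \<subseteq> map_prod f f ` parcs G"
    proof (rule subrelI)
      fix p q
      assume arc: "(p, q) \<in> parcs H"
      then obtain u v where "u \<in> pverts G" "p = f u" "v \<in> pverts G" "q = f v"
        using H.wellformed'[OF arc] surj by blast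
      with arc assms(4) show "(p, q) \<in> map_prod f f ` parcs G"
        by force
    qed
  qed
  then have "with_proj H = app_iso ?hom (with_proj G)"
    using surj by (simp add: app_iso_def with_proj_def)
  ultimately show ?thesis
    unfolding digraph_iso_def by blast
qed

section \<open>Distance graphs\<close>

definition distance_graph :: "nat \<Rightarrow> nat set \<Rightarrow> nat pair_pre_digraph" where
  "distance_graph N D =
    \<lparr> pverts = {..<N},
      parcs = {(u, v). u < N \<and> v < N \<and> (\<exists>d\<in>D. v = u + d \<or> u = v + d)} \<rparr>"

lemma pverts_distance_graph [simp]: "pverts (distance_graph N D) = {..<N}"
  by (simp add: distance_graph_def)

lemma parcs_distance_graph_iff:
  "(u, v) \<in> parcs (distance_graph N D) \<longleftrightarrow>
    u < N \<and> v < N \<and> (\<exists>d\<in>D. v = u + d \<or> u = v + d)"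
  by (simp add: distance_graph_def)

lemma pair_sym_digraph_distance_graph: "pair_sym_digraph (distance_graph N D)"
  by unfold_locales (auto simp: distance_graph_def symmetric_def intro: symI)

lemma connected_distance_graph_consecutive:
  assumes "0 < d" and "0 < N" and "N = 1 \<or> 2 * d \<le> N"
  shows "Digraph_Component.connected (with_proj (distance_graph N {d, Suc d}))"
proof -
  let ?G = "distance_graph N {d, Suc d}"
  interpret pair_sym_digraph ?G
    by (rule pair_sym_digraph_distance_graph)
  have "v \<rightarrow>\<^sup>*\<^bsub>with_proj ?G\<^esub> 0" if "v < N" for v
    using that
  proof (induction v rule: less_induct)
    case (less v)
    consider (zero) "v = 0" | (ge) "d \<le> v" | (small) "0 < v" "v < d"
      by linarith
    then show ?case
    proof cases
      case zero
      then show ?thesis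
        using less.prems by simp
    next
      case ge
      then have "(v, v - d) \<in> parcs ?G"
        using less.prems by (auto simp: parcs_distance_graph_iff)
      also have "(v - d) \<rightarrow>\<^sup>*\<^bsub>with_proj ?G\<^esub> 0"
        using ge assms(1) less by simp
      finally show ?thesis .
    next
      case small
      then have "v + d < N"
        using assms(3) less.prems by auto
      then have "(v, v + d) \<in> parcs ?G" and "(v + d, v - 1) \<in> parcs ?G"
        using small by (auto simp: parcs_distance_graph_iff)
      moreover have "(v - 1) \<rightarrow>\<^sup>*\<^bsub>with_proj ?G\<^esub> 0"
        using small less by simp
      ultimately show ?thesis
        by (blast intro: adj_reachable_trans)
    qed
  qed
  then show ?thesis
    using assms(2) by (intro connected_if_reachable_root[of 0]) auto
qed

lemma not_connected_distance_graph:
  assumes "1 < N" and "N < 2 * d" and "\<And>d'. d' \<in> D \<Longrightarrow> d \<le> d'"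
  shows "\<not> Digraph_Component.connected (with_proj (distance_graph N D))"
proof
  interpret pair_sym_digraph "distance_graph N D"
    by (rule pair_sym_digraph_distance_graph)
  assume conn: "Digraph_Component.connected (with_proj (distance_graph N D))"
  define w where "w = min (d - 1) (N - 1)"
  have "w < N" "w < d" "N \<le> w + d"
    using assms(1,2) by (auto simp: w_def)
  then have isolated: "(w, v) \<notin> parcs (distance_graph N D)"
    "(v, w) \<notin> parcs (distance_graph N D)" for v
    using assms(3) by (fastforce simp: parcs_distance_graph_iff)+
  have "parcs (distance_graph N D) \<noteq> {}"
  proof
    assume "parcs (distance_graph N D) = {}"
    then obtain v where "{..<N} = {v}"
      using connected_arcs_empty[OF conn] assms(1) by auto
    then have "card {..<N} = 1"
      by simp
    with assms(1) show False
      by simp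
  qed
  then have "{..<N} = fst ` parcs (distance_graph N D) \<union> snd ` parcs (distance_graph N D)"
    using connected_verts[OF conn] by simp
  with \<open>w < N\<close> isolated show False
    by (metis UnE imageE lessThan_iff prod.collapse)
qed

lemma connected_distance_graph_consecutive_iff:
  assumes "0 < d" and "0 < N"
  shows "Digraph_Component.connected (with_proj (distance_graph N {d, Suc d})) \<longleftrightarrow>
    N = 1 \<or> 2 * d \<le> N"
proof
  assume "Digraph_Component.connected (with_proj (distance_graph N {d, Suc d}))"
  then show "N = 1 \<or> 2 * d \<le> N"
    using not_connected_distance_graph[of N d "{d, Suc d}"] assms(2) by fastforce
next
  assume "N = 1 \<or> 2 * d \<le> N"
  with assms show "Digraph_Component.connected (with_proj (distance_graph N {d, Suc d}))"
    by (rule connected_distance_graph_consecutive)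
qed

section \<open>Collinear points and one further point\<close>

lemma order_convex_nat_eq_atLeastLessThan:
  fixes J :: "nat set"
  assumes "J \<subseteq> {..<m}"
    and "\<And>a b t. a \<in> J \<Longrightarrow> b \<in> J \<Longrightarrow> a \<le> t \<Longrightarrow> t \<le> b \<Longrightarrow> t \<in> J"
  obtains a b where "b \<le> m" and "J = {a..<b}"
proof (cases "J = {}")
  case True
  then show ?thesis
    using that[of 0 0] by simp
next
  case False
  have "finite J"
    using assms(1) by (rule finite_subset) simp
  note Min_Max_in = Min_in[OF \<open>finite J\<close> False] Max_in[OF \<open>finite J\<close> False]
  have "{Min J..Max J} \<subseteq> J"
    using assms(2)[OF Min_Max_in] by (simp add: subset_iff)
  moreover have "J \<subseteq> {Min J..Max J}"
    using \<open>finite J\<close> by auto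
  ultimately have "J = {Min J..<Suc (Max J)}"
    unfolding atLeastLessThanSuc_atLeastAtMost by (rule equalityI[rotated])
  moreover have "Suc (Max J) \<le> m"
    using Min_Max_in(2) assms(1) by auto
  ultimately show ?thesis
    using that by blast
qed

lemma convex_hull_insert_Int_hyperplane:
  fixes f :: "'a::real_vector \<Rightarrow> real"
  assumes "linear f" and "convex A" and "A \<subseteq> {p. f p = c}" and "f x \<noteq> c"
  shows "convex hull (insert x A) \<inter> {p. f p = c} = A"
proof
  show "A \<subseteq> convex hull (insert x A) \<inter> {p. f p = c}"
    using assms(3) hull_subset[of "insert x A" convex] by blast
  show "convex hull (insert x A) \<inter> {p. f p = c} \<subseteq> A"
  proof
    fix z
    assume z: "z \<in> convex hull (insert x A) \<inter> {p. f p = c}"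
    then have "A \<noteq> {}"
      using assms(4) by auto
    then obtain u b where "b \<in> A" and z_eq: "z = (1 - u) *\<^sub>R x + u *\<^sub>R b"
      using z assms(2) by (auto simp: convex_hull_insert_alt hull_same)
    then have "c = (1 - u) * f x + u * c"
      using z assms(1,3) by (auto simp: linear_add linear_scale)
    then have "(1 - u) * (f x - c) = 0"
      by (simp add: algebra_simps)
    then have "u = 1"
      using assms(4) by simp
    then show "z \<in> A"
      using z_eq \<open>b \<in> A\<close> by simp
  qed
qed

lemma finite_horizontal_set_enum:
  fixes S :: "('a::linorder \<times> 'b) set"
  assumes "finite S" and "S \<subseteq> {p. snd p = c}"
  obtains e where "strict_mono_on {..<card S} e" and "S = (\<lambda>t. (e t, c)) ` {..<card S}"
proof
  define xs where "xs = sorted_list_of_set (fst ` S)"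
  have "inj_on fst S"
    using assms(2) by (intro inj_onI prod_eqI) auto
  then have len: "length xs = card S"
    by (simp add: xs_def card_image)
  then show "strict_mono_on {..<card S} ((!) xs)"
    by (auto simp: xs_def intro!: strict_mono_onI sorted_wrt_nth_less[of "(<)"])
  have "(\<lambda>t. (xs ! t, c)) ` {..<card S} = (\<lambda>a. (a, c)) ` (!) xs ` {..<card S}"
    by (simp add: image_image)
  also have "(!) xs ` {..<card S} = fst ` S"
    using nth_image[of "card S" xs] len assms(1) by (simp add: xs_def lessThan_atLeast0)
  also have "(\<lambda>a. (a, c)) ` fst ` S = S"
    using assms(2) by force
  finally show "S = (\<lambda>t. (xs ! t, c)) ` {..<card S}" ..
qed

locale collinear_points_and_apex =
  fixes e :: "nat \<Rightarrow> real" and c :: real and m :: nat and x :: "real \<times> real"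
  assumes strict_mono_e: "strict_mono_on {..<m} e"
    and apex: "snd x \<noteq> c"
begin

definition run :: "nat \<Rightarrow> nat \<Rightarrow> (real \<times> real) set" where
  "run a b = (\<lambda>t. (e t, c)) ` {a..<b}"

definition points :: "(real \<times> real) set" where
  "points = insert x (run 0 m)"

text \<open>Number \<open>2a\<close> consists of \<^term>\<open>x\<close> and the \<open>k - 1\<close> points from the \<open>a\<close>-th on,
  number \<open>2a + 1\<close> of the \<open>k\<close> points from the \<open>a\<close>-th on.\<close>

definition nth_island :: "nat \<Rightarrow> nat \<Rightarrow> (real \<times> real) set" where
  "nth_island k u =
    (if even u then {x} else {}) \<union> run (u div 2) (Suc u div 2 + (k - 1))"

lemma inj_on_point: "inj_on (\<lambda>t. (e t, c)) {..<m}"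
  using strict_mono_on_imp_inj_on[OF strict_mono_e] by (auto simp: inj_on_def)

lemma abscissa_le_iff: "i < m \<Longrightarrow> j < m \<Longrightarrow> e i \<le> e j \<longleftrightarrow> i \<le> j"
  using strict_mono_e by (simp add: strict_mono_on_less_eq)

lemma run_subset_line: "run a b \<subseteq> {p. snd p = c}"
  by (auto simp: run_def)

lemma finite_run [simp]: "finite (run a b)"
  by (simp add: run_def)

lemma apex_notin_run [simp]: "x \<notin> run a b"
  using apex run_subset_line by auto

lemma card_run: "b \<le> m \<Longrightarrow> card (run a b) = b - a"
  unfolding run_def by (subst card_image) (auto intro: inj_on_subset[OF inj_on_point])

lemma run_Int_run:
  assumes "b \<le> m" and "b' \<le> m"
  shows "run a b \<inter> run a' b' = run (max a a') (min b b')"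
proof -
  have "run a b \<inter> run a' b' = (\<lambda>t. (e t, c)) ` ({a..<b} \<inter> {a'..<b'})"
    unfolding run_def using assms
    by (intro inj_on_image_Int[OF inj_on_point, symmetric]) auto
  then show ?thesis
    by (simp add: run_def)
qed

lemma run_Int_convex:
  assumes "convex C"
  obtains a b where "b \<le> m" and "run 0 m \<inter> C = run a b"
proof -
  define J where "J = {t. t < m \<and> (e t, c) \<in> C}"
  have "t \<in> J" if "a \<in> J" "b \<in> J" "a \<le> t" "t \<le> b" for a b t
  proof -
    have "t < m" "e a \<le> e t" "e t \<le> e b"
      using that by (auto simp: J_def abscissa_le_iff)
    then have "(e t, c) \<in> closed_segment (e a, c) (e b, c)"
      by (subst closed_segment_same_snd) (auto simp: closed_segment_eq_real_ivl)
    then show ?thesis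
      using assms that \<open>t < m\<close> by (auto simp: J_def convex_contains_segment)
  qed
  moreover have "J \<subseteq> {..<m}"
    by (auto simp: J_def)
  ultimately obtain a b where "b \<le> m" "J = {a..<b}"
    using order_convex_nat_eq_atLeastLessThan by metis
  have "run 0 m \<inter> C = (\<lambda>t. (e t, c)) ` J"
    by (auto simp: J_def run_def)
  also have "\<dots> = run a b"
    by (simp add: \<open>J = {a..<b}\<close> run_def)
  finally show ?thesis
    using that \<open>b \<le> m\<close> by blast
qed

lemma run_eq_Int_convex:
  assumes "b \<le> m"
  obtains A where "convex A" and "A \<subseteq> {p. snd p = c}" and "run a b = run 0 m \<inter> A"
proof (cases "a < b")
  case True
  let ?A = "{e a..e (b - 1)} \<times> {c}"
  have "run a b = run 0 m \<inter> ?A"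
    using True assms by (auto simp: run_def abscissa_le_iff)
  then show ?thesis
    by (intro that[of ?A]) (auto intro: convex_Times convex_closed_interval)
next
  case False
  then show ?thesis
    using that[of "{}"] by (simp add: run_def)
qed

lemma island_points_iff:
  "island points I \<longleftrightarrow> (\<exists>a b. b \<le> m \<and> (I = run a b \<or> I = insert x (run a b)))"
proof
  assume "island points I"
  then obtain C where C: "convex C" "I = points \<inter> C"
    by (auto simp: island_def)
  obtain a b where "b \<le> m" "run 0 m \<inter> C = run a b"
    using C(1) by (rule run_Int_convex)
  then show "\<exists>a b. b \<le> m \<and> (I = run a b \<or> I = insert x (run a b))"
    using C(2) by (auto simp: points_def)
next
  assume "\<exists>a b. b \<le> m \<and> (I = run a b \<or> I = insert x (run a b))"
  then obtain a b where "b \<le> m" and I: "I = run a b \<or> I = insert x (run a b)"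
    by blast
  then obtain A where A: "convex A" "A \<subseteq> {p. snd p = c}" "run a b = run 0 m \<inter> A"
    using run_eq_Int_convex by metis
  from I show "island points I"
  proof
    assume "I = run a b"
    also have "\<dots> = points \<inter> A"
      using A apex by (auto simp: points_def)
    finally show ?thesis
      using A(1) by (auto simp: island_def)
  next
    assume "I = insert x (run a b)"
    also have "run a b = run 0 m \<inter> (convex hull (insert x A) \<inter> {p. snd p = c})"
      using A apex by (subst convex_hull_insert_Int_hyperplane) (auto simp: linear_snd)
    also have "insert x \<dots> = points \<inter> convex hull (insert x A)"
      using run_subset_line[of 0 m] hull_inc[of x "insert x A" convex]
      unfolding points_def by blast
    finally show ?thesis
      using convex_convex_hull unfolding island_def by blast
  qed
qed

lemma nth_island_end_le:
  assumes "0 < k" and "k \<le> m + 1" and "u \<le> 2 * (m + 1 - k)"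
  shows "Suc u div 2 + (k - 1) \<le> m"
proof -
  have "Suc u div 2 \<le> m + 1 - k"
    using assms(3) by simp
  with assms(1,2) show ?thesis
    by simp
qed

lemma k_island_nth_island:
  assumes "2 \<le> k" and "k \<le> m + 1" and "u \<le> 2 * (m + 1 - k)"
  shows "k_island points k (nth_island k u)"
proof -
  have end_le: "Suc u div 2 + (k - 1) \<le> m"
    using assms by (intro nth_island_end_le) auto
  then have "island points (nth_island k u)"
    unfolding nth_island_def island_points_iff by force
  moreover have "card (nth_island k u) = k"
    using end_le assms(1) by (auto simp: nth_island_def card_run elim!: oddE)
  ultimately show ?thesis
    by (simp add: k_island_def nth_island_def)
qed

lemma k_island_eq_nth_island:
  assumes "2 \<le> k" and "k \<le> m + 1" and "k_island points k I"
  obtains u where "u \<le> 2 * (m + 1 - k)" and "I = nth_island k u"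
proof -
  obtain a b where "b \<le> m" "card I = k" and "I = run a b \<or> I = insert x (run a b)"
    using assms(3) by (auto simp: k_island_def island_points_iff)
  from this(3) show ?thesis
  proof
    assume I: "I = run a b"
    then have "b = a + k"
      using card_run \<open>b \<le> m\<close> \<open>card I = k\<close> assms(1) by auto
    then show ?thesis
      using I \<open>b \<le> m\<close> assms(1) by (intro that[of "2 * a + 1"]) (auto simp: nth_island_def)
  next
    assume I: "I = insert x (run a b)"
    then have "b = a + (k - 1)"
      using card_run \<open>b \<le> m\<close> \<open>card I = k\<close> assms(1) by auto
    then show ?thesis
      using I \<open>b \<le> m\<close> assms(1) by (intro that[of "2 * a"]) (auto simp: nth_island_def)
  qed
qed

lemma card_nth_island_Int:
  assumes "0 < k" and "k \<le> m + 1" and "u \<le> v" and "v \<le> 2 * (m + 1 - k)"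
  shows "card (nth_island k u \<inter> nth_island k v) =
    (if even u \<and> even v then 1 else 0) + (Suc u div 2 + (k - 1) - v div 2)"
proof -
  let ?R = "run (v div 2) (Suc u div 2 + (k - 1))"
  have end_le: "Suc u div 2 + (k - 1) \<le> m" "Suc v div 2 + (k - 1) \<le> m"
    using assms by (auto intro!: nth_island_end_le)
  have "u div 2 \<le> v div 2" "Suc u div 2 \<le> Suc v div 2"
    using assms(3) by (auto intro: div_le_mono)
  then have "run (u div 2) (Suc u div 2 + (k - 1)) \<inter> run (v div 2) (Suc v div 2 + (k - 1)) = ?R"
    using end_le by (simp add: run_Int_run max_def min_def)
  then have "nth_island k u \<inter> nth_island k v = (if even u \<and> even v then {x} else {}) \<union> ?R"
    by (auto simp: nth_island_def)
  then show ?thesis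
    using end_le(1) by (simp add: card_run)
qed

lemma card_nth_island_Int_eq_iff:
  assumes "2 \<le> t" and "t \<le> k" and "k \<le> m + 1" and "u \<le> v" and "v \<le> 2 * (m + 1 - k)"
  shows "card (nth_island k u \<inter> nth_island k v) = t \<longleftrightarrow>
    v = u + 2 * (k - t) \<or> Suc v = u + 2 * (k - t)"
proof -
  have "card (nth_island k u \<inter> nth_island k v) =
      (if even u \<and> even v then 1 else 0) + (Suc u div 2 + (k - 1) - v div 2)"
    using assms by (intro card_nth_island_Int) auto
  moreover obtain s where "k = t + s"
    using assms(2) le_Suc_ex by blast
  moreover have "Suc (2 * j) \<noteq> 2 * (i + s)" for i j
    by presburger
  ultimately show ?thesis
    using assms(1,4) by (cases "even u"; cases "even v"; elim evenE oddE) auto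
qed

lemma bij_betw_nth_island:
  assumes "2 \<le> k" and "k \<le> m + 1"
  shows "bij_betw (nth_island k) {..2 * (m + 1 - k)} {I. k_island points k I}"
  unfolding bij_betw_def
proof
  show "inj_on (nth_island k) {..2 * (m + 1 - k)}"
  proof (rule linorder_inj_onI')
    fix u v
    assume "u \<in> {..2 * (m + 1 - k)}" "v \<in> {..2 * (m + 1 - k)}" "u < v"
    then have "card (nth_island k u \<inter> nth_island k v) \<noteq> k"
      using assms card_nth_island_Int_eq_iff[of k k u v] by auto
    moreover have "k_island points k (nth_island k u)"
      using k_island_nth_island[OF assms] \<open>u \<in> _\<close> by simp
    ultimately show "nth_island k u \<noteq> nth_island k v"
      by (auto simp: k_island_def)
  qed
  show "nth_island k ` {..2 * (m + 1 - k)} = {I. k_island points k I}"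
    using k_island_nth_island[OF assms] k_island_eq_nth_island[OF assms] by blast
qed

lemma arc_nth_island_iff:
  assumes "2 \<le> l" and "l < k" and "k \<le> m + 1"
    and "u \<le> 2 * (m + 1 - k)" and "v \<le> 2 * (m + 1 - k)"
  shows "(nth_island k u, nth_island k v) \<in> parcs (IJ points k l) \<longleftrightarrow>
    (\<exists>d\<in>{2 * (k - l) - 1, 2 * (k - l)}. v = u + d \<or> u = v + d)"
proof -
  have isl: "k_island points k (nth_island k u)" "k_island points k (nth_island k v)"
    using k_island_nth_island assms by auto
  then have "(nth_island k u, nth_island k v) \<in> parcs (IJ points k l) \<longleftrightarrow>
    card (nth_island k u \<inter> nth_island k v) = l"
    using assms(2) by (auto simp: IJ_def k_island_def)
  also have "\<dots> \<longleftrightarrow> (\<exists>d\<in>{2 * (k - l) - 1, 2 * (k - l)}. v = u + d \<or> u = v + d)"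
  proof (cases "u \<le> v")
    case True
    then show ?thesis
      using card_nth_island_Int_eq_iff[of l k u v] assms by auto
  next
    case False
    then show ?thesis
      using card_nth_island_Int_eq_iff[of l k v u] assms by (auto simp: Int_commute)
  qed
  finally show ?thesis .
qed

theorem digraph_iso_distance_graph_IJ:
  assumes "2 \<le> l" and "l < k" and "k \<le> m + 1"
  shows "digraph_iso
    (with_proj (distance_graph (Suc (2 * (m + 1 - k))) {2 * (k - l) - 1, 2 * (k - l)}))
    (with_proj (IJ points k l))"
proof (rule digraph_iso_with_projI)
  let ?G = "distance_graph (Suc (2 * (m + 1 - k))) {2 * (k - l) - 1, 2 * (k - l)}"
  interpret distance_graph: pair_sym_digraph ?G
    by (rule pair_sym_digraph_distance_graph)
  show "pair_wf_digraph ?G" ..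
  interpret IJ: pair_graph "IJ points k l"
    by (rule pair_graph_IJ) (simp add: points_def)
  show "pair_wf_digraph (IJ points k l)" ..
  show "bij_betw (nth_island k) (pverts ?G) (pverts (IJ points k l))"
    using bij_betw_nth_island[of k] assms by (simp add: IJ_def lessThan_Suc_atMost)
  fix u v
  assume "u \<in> pverts ?G" and "v \<in> pverts ?G"
  then show "(nth_island k u, nth_island k v) \<in> parcs (IJ points k l) \<longleftrightarrow> (u, v) \<in> parcs ?G"
    using arc_nth_island_iff[OF assms, of u v] by (simp add: parcs_distance_graph_iff)
qed

corollary connected_IJ_points_iff:
  assumes "2 \<le> l" and "l < k" and "k \<le> m + 1"
  shows "Digraph_Component.connected (with_proj (IJ points k l)) \<longleftrightarrow>
    k = m + 1 \<or> 2 * (k - l) \<le> m + 2 - k"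
proof -
  define d N where "d = 2 * (k - l) - 1" and "N = Suc (2 * (m + 1 - k))"
  interpret distance_graph: pair_sym_digraph "distance_graph N {d, Suc d}"
    by (rule pair_sym_digraph_distance_graph)
  have "Suc d = 2 * (k - l)"
    using assms(2) by (simp add: d_def)
  then have "digraph_iso (with_proj (distance_graph N {d, Suc d})) (with_proj (IJ points k l))"
    using digraph_iso_distance_graph_IJ[OF assms] by (simp add: d_def N_def)
  then have "Digraph_Component.connected (with_proj (IJ points k l)) \<longleftrightarrow>
      Digraph_Component.connected (with_proj (distance_graph N {d, Suc d}))"
    using connected_iff_if_digraph_iso distance_graph.wf_digraph_axioms by metis
  also have "\<dots> \<longleftrightarrow> N = 1 \<or> 2 * d \<le> N"
    using assms(2) by (intro connected_distance_graph_consecutive_iff) (auto simp: d_def N_def)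
  also have "\<dots> \<longleftrightarrow> k = m + 1 \<or> 2 * (k - l) \<le> m + 2 - k"
    using assms by (auto simp: d_def N_def)
  finally show ?thesis .
qed

end

theorem theorem4:
  fixes S S' h :: "(real \<times> real) set" and x :: "real \<times> real" and c :: real
    and n k l :: nat
  assumes "h = {p. snd p = c}"
    and "finite S" and "card S = n - 1" and "S \<subseteq> h"
    and "x \<notin> h"
    and "S' = S \<union> {x}"
    and "2 \<le> l" and "l < k" and "k \<le> n"
  shows "Digraph_Component.connected (with_proj (IJ S' k l)) \<longleftrightarrow>
           int n \<ge> 3 * int k - 2 * int l - 1 \<or> n = k"
proof -
  obtain e where strict_mono_e: "strict_mono_on {..<n - 1} e"
    and S_eq: "S = (\<lambda>t. (e t, c)) ` {..<n - 1}"
    using finite_horizontal_set_enum[of S c] assms(1-4) by auto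
  interpret collinear_points_and_apex e c "n - 1" x
    using strict_mono_e assms(1,5) by unfold_locales auto
  have "S' = points"
    using assms(6) S_eq unfolding points_def run_def lessThan_atLeast0 by simp
  then have "Digraph_Component.connected (with_proj (IJ S' k l)) \<longleftrightarrow>
      k = n - 1 + 1 \<or> 2 * (k - l) \<le> n - 1 + 2 - k"
    using connected_IJ_points_iff[of l k] assms(7-9) by simp
  also have "\<dots> \<longleftrightarrow> int n \<ge> 3 * int k - 2 * int l - 1 \<or> n = k"
    using assms(7-9) by auto
  finally show ?thesis .
qed

end
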